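(* Let $c$ be a medium with a bounded defect in $(x_0,x_1)$, with $x_0<x_1$, and let $T(\omega)$, $D^L(\omega)$ be the transfer matrix of the periodic part and the defect matrix. Let $u$ be a localised eigenmode of $u''+\frac{\omega^2}{c^2(x)}u=0$ with eigenfrequency $\omega\in\mathbb{R}\setminus\sigma(c_0)$, and let $(V_{11}(\omega),V_{21}(\omega))^\top$ be an eigenvector of $T(\omega)$ associated to the eigenvalue $\lambda_1$ of $T(\omega)$ with $|\lambda_1|<1$. Then $$\begin{pmatrix} -V_{21}(\omega) & V_{11}(\omega)\end{pmatrix} D^L(\omega)\begin{pmatrix} V_{11}(\omega)\\ -V_{21}(\omega)\end{pmatrix}=0.$$ Furthermore, the localised eigenmode satisfies $V_{21}(\omega)\,u(x_0)=-V_{11}(\omega)\,u'(x_0)$.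
   Context: Medium with a bounded defect: let $h>0$ and let $\{x_n:n\in\mathbb{Z}\}\subset\mathbb{R}$ satisfy $x_{n+1}-x_n=h$ for all $n\in\mathbb{Z}\setminus\{0\}$, with $x_1-x_0>0$ not necessarily equal to $h$. The function $c:\mathbb{R}\to\mathbb{R}$ is strictly positive and piecewise smooth (finitely many smooth pieces on bounded intervals, with positive one-sided limits), and outside the defect region $(x_0,x_1)$ it is periodic, $c(x_n+t)=c(x_m+t)$ for all $t\in[0,h)$ and $n,m\in\mathbb{Z}\setminus\{0\}$, and symmetric, $c(x_n+t)=c(x_{n+1}-t)$ for all $t\in[0,h)$ and $n\in\mathbb{Z}\setminus\{0\}$. Inside $(x_0,x_1)$ it is otherwise arbitrary. Solutions: a solution of $u''+\frac{\omega^2}{c^2(x)}u=0$ is a $C^1$ function $u\not\equiv 0$ whose derivative is locally absolutely continuous and which satisfies the equation away from the discontinuities of $c$. A localised eigenmode with eigenfrequency $\omega$ is a solution $u\in L^2(\mathbb{R})$ that decays at $\pm\infty$; in particular $u(x_n)\to0$ and $u'(x_n)\to 0$ as $n\to\pm\infty$. Spectrum of the unperturbed medium: $c_0$ denotes the $h$-periodic medium without defect (i.e. with $x_0=x_1$), obtained by repeating the unit cell. $\sigma(c_0)$ is the set of $\omega$ for which the equation with $c=c_0$ has a nonzero solution that is either in $L^2(\mathbb{R})$ or, for some $\alpha\in\mathbb{R}$, satisfies $u(x+h)=e^{\mathrm{i}\alpha h}u(x)$. Matrices: $T(\omega)\in\mathbb{R}^{2\times2}$ is the matrix such that any solution of the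 equation satisfies $(u(x_{n+1}),u'(x_{n+1}))^\top=T(\omega)(u(x_n),u'(x_n))^\top$ for $n\in\mathbb{Z}\setminus\{0\}$. For $\omega\in\mathbb{R}\setminus\sigma(c_0)$ the eigenvalues of $T(\omega)$ are real with $|\lambda_1|<1<|\lambda_2|$. The defect matrix is $$D^L(\omega)=\begin{pmatrix}\psi_1(x_1)&\psi_2(x_1)\\ \psi_1'(x_1)&\psi_2'(x_1)\end{pmatrix},$$ where $\psi_1,\psi_2$ solve $\psi''+\frac{\omega^2}{c^2(x)}\psi=0$ on $[x_0,x_1]$ with $\psi_1(x_0)=1,\psi_1'(x_0)=0$ and $\psi_2(x_0)=0,\psi_2'(x_0)=1$. *)

theory Defs
  imports "HOL-Analysis.Analysis"
begin

text \<open>Absolute continuity on a compact interval; \<open>\<D>\<close> ranges over finite families of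
  non-overlapping closed subintervals, \<open>{Inf K..Sup K}\<close> being the interval \<open>K\<close>.\<close>

definition abs_continuous_on :: "real set \<Rightarrow> (real \<Rightarrow> 'a::real_normed_vector) \<Rightarrow> bool" where
  "abs_continuous_on S f \<longleftrightarrow>
     (\<forall>\<epsilon>>0. \<exists>\<delta>>0. \<forall>\<D>. \<D> division_of \<Union>\<D> \<and> \<Union>\<D> \<subseteq> S \<and> (\<Sum>K\<in>\<D>. Sup K - Inf K) < \<delta>
        \<longrightarrow> (\<Sum>K\<in>\<D>. norm (f (Sup K) - f (Inf K))) < \<epsilon>)"

text \<open>Smooth off finitely many points of each bounded interval; nothing is required at these
  exceptional points.\<close>

definition piecewise_smooth :: "(real \<Rightarrow> real) \<Rightarrow> bool" where
  "piecewise_smooth c \<longleftrightarrow>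
     (\<forall>a b. \<exists>P. finite P \<and>
        (\<forall>y\<in>{a<..<b} - P. \<forall>k. (deriv ^^ k) c field_differentiable (at y)))"

locale defect_medium =
  fixes h :: real and x :: "int \<Rightarrow> real" and c :: "real \<Rightarrow> real"
  assumes h_pos: "h > 0"
    and grid: "\<And>n. n \<noteq> 0 \<Longrightarrow> x (n + 1) - x n = h"
    and defect_nonempty: "x 0 < x 1"
    and c_pos: "\<And>y. c y > 0"
    and c_smooth: "piecewise_smooth c"
    and c_left_limit: "\<And>y. \<exists>l>0. (c \<longlongrightarrow> l) (at_left y)"
    and c_right_limit: "\<And>y. \<exists>l>0. (c \<longlongrightarrow> l) (at_right y)"
    and c_periodic: "\<And>n m t. n \<noteq> 0 \<Longrightarrow> m \<noteq> 0 \<Longrightarrow> t \<in> {0..<h} \<Longrightarrow> c (x n + t) = c (x m + t)"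
    and c_symmetric: "\<And>n t. n \<noteq> 0 \<Longrightarrow> t \<in> {0..<h} \<Longrightarrow> c (x n + t) = c (x (n + 1) - t)"

text \<open>The derivative relative to \<open>S\<close>, so one-sided at endpoints of an interval belonging to it.\<close>

abbreviation deriv_on :: "real set \<Rightarrow> (real \<Rightarrow> 'a::real_normed_vector) \<Rightarrow> real \<Rightarrow> 'a" where
  "deriv_on S u y \<equiv> vector_derivative u (at y within S)"

text \<open>Solutions \<open>u \<noteq> 0\<close> of \<open>u'' + \<omega>\<^sup>2/c\<^sup>2 u = 0\<close> on an interval \<open>S\<close>, with real or complex values.\<close>

definition solution_on ::
    "real set \<Rightarrow> (real \<Rightarrow> real) \<Rightarrow> real \<Rightarrow> (real \<Rightarrow> 'a::real_normed_vector) \<Rightarrow> bool" where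
  "solution_on S c \<omega> u \<longleftrightarrow>
     (\<exists>y\<in>S. u y \<noteq> 0) \<and>
     u differentiable_on S \<and> continuous_on S (deriv_on S u) \<and>
     (\<forall>a b. {a..b} \<subseteq> S \<longrightarrow> abs_continuous_on {a..b} (deriv_on S u)) \<and>
     (\<forall>y\<in>interior S. isCont c y \<longrightarrow>
        (deriv_on S u has_vector_derivative - ((\<omega>\<^sup>2 / (c y)\<^sup>2) *\<^sub>R u y)) (at y))"

definition square_integrable :: "(real \<Rightarrow> complex) \<Rightarrow> bool" where
  "square_integrable u \<longleftrightarrow> u \<in> borel_measurable lborel \<and> integrable lborel (\<lambda>y. (cmod (u y))\<^sup>2)"

text \<open>The decay of \<open>u'\<close> at the points \<open>x\<^sub>n\<close> is not part of the definition: it follows from the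
  equation, as \<open>c\<close> is bounded away from zero.\<close>

definition localised_eigenmode :: "(real \<Rightarrow> real) \<Rightarrow> real \<Rightarrow> (real \<Rightarrow> complex) \<Rightarrow> bool" where
  "localised_eigenmode c \<omega> u \<longleftrightarrow>
     solution_on UNIV c \<omega> u \<and> square_integrable u \<and>
     (u \<longlongrightarrow> 0) at_top \<and> (u \<longlongrightarrow> 0) at_bot"

text \<open>The medium without defect: the unit cell \<open>[x\<^sub>1, x\<^sub>1 + h)\<close> repeated \<open>h\<close>-periodically.\<close>

definition unperturbed :: "real \<Rightarrow> (int \<Rightarrow> real) \<Rightarrow> (real \<Rightarrow> real) \<Rightarrow> real \<Rightarrow> real" where
  "unperturbed h x c y = c (x 1 + h * frac ((y - x 1) / h))"

definition spectrum :: "real \<Rightarrow> (real \<Rightarrow> real) \<Rightarrow> real set" where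
  "spectrum h c\<^sub>0 =
     {\<omega>. \<exists>u::real \<Rightarrow> complex. solution_on UNIV c\<^sub>0 \<omega> u \<and>
        (square_integrable u \<or>
         (\<exists>\<alpha>::real. \<forall>y. u (y + h) = exp (\<i> * of_real (\<alpha> * h)) * u y))}"

definition state :: "(real \<Rightarrow> complex) \<Rightarrow> real \<Rightarrow> complex^2" where
  "state u y = vector [u y, vector_derivative u (at y)]"

definition is_transfer_matrix ::
    "(int \<Rightarrow> real) \<Rightarrow> (real \<Rightarrow> real) \<Rightarrow> real \<Rightarrow> real^2^2 \<Rightarrow> bool" where
  "is_transfer_matrix x c \<omega> T \<longleftrightarrow>
     (\<forall>u. solution_on UNIV c \<omega> u \<longrightarrow>
        (\<forall>n. n \<noteq> 0 \<longrightarrow> state u (x (n + 1)) = map_matrix complex_of_real T *v state u (x n)))"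

definition is_defect_matrix ::
    "real \<Rightarrow> real \<Rightarrow> (real \<Rightarrow> real) \<Rightarrow> real \<Rightarrow> real^2^2 \<Rightarrow> bool" where
  "is_defect_matrix a b c \<omega> D \<longleftrightarrow>
     (\<exists>\<psi>\<^sub>1 \<psi>\<^sub>2 :: real \<Rightarrow> real.
        solution_on {a..b} c \<omega> \<psi>\<^sub>1 \<and> \<psi>\<^sub>1 a = 1 \<and> deriv_on {a..b} \<psi>\<^sub>1 a = 0 \<and>
        solution_on {a..b} c \<omega> \<psi>\<^sub>2 \<and> \<psi>\<^sub>2 a = 0 \<and> deriv_on {a..b} \<psi>\<^sub>2 a = 1 \<and>
        D = vector [vector [\<psi>\<^sub>1 b, \<psi>\<^sub>2 b],
                    vector [deriv_on {a..b} \<psi>\<^sub>1 b, deriv_on {a..b} \<psi>\<^sub>2 b]])"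

definition is_eigenvector :: "complex^'n^'n \<Rightarrow> complex \<Rightarrow> complex^'n \<Rightarrow> bool" where
  "is_eigenvector A l v \<longleftrightarrow> v \<noteq> 0 \<and> A *v v = l *s v"

end

theory Submission
  imports Defs
begin

text \<open>
  The theorem rests on the mirror symmetry of the medium and on the Wronskian. Outside
  the defect the medium is mirror symmetric about the centre \<open>(x 0 + x 1) / 2\<close>: periodicity and
  the symmetry of the unit cell give \<open>c (x 0 + x 1 - y) = c y\<close> for \<open>y \<ge> x 1\<close>. Hence, on \<open>[x 1, \<infinity>)\<close>, both the localised mode
  \<open>u\<close> and its mirror image \<open>w y = u (x 0 + x 1 - y)\<close> solve the same equation
  (\<open>c_mirror\<close>, \<open>solution_pair_reflect\<close>). Both decay, and so do their derivatives
  (\<open>derivative_decays\<close>), so their constant Wronskian vanishes and \<open>u\<close> is a multiple of \<open>w\<close>. With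
  \<open>S = diag (1, -1)\<close> and \<open>U n = (u (x n), u' (x n))\<close> this says at \<open>x 1\<close> that \<open>U 1\<close> is parallel to
  \<open>S (U 0)\<close>.

  It remains to see that \<open>U 1\<close> is parallel to the eigenvector \<open>V\<close>. The relation between \<open>u\<close> and \<open>w\<close>
  at the other grid points turns the transfer relation on the left of the defect into
  \<open>T (S (U (n + 1))) = S (U n)\<close> for \<open>n \<ge> 1\<close>, besides \<open>T (U n) = U (n + 1)\<close>. These two relations
  and \<open>U n \<longlonglongrightarrow> 0\<close> force \<open>det T = 1\<close> (\<open>det_transfer_eq_1\<close>), and then the area spanned by \<open>U n\<close> and
  \<open>T\<^sup>n V\<close> is independent of \<open>n\<close> and tends to \<open>0\<close> (\<open>decaying_orbit_parallel_eigenvector\<close>).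
  Uniqueness for the equation enters through an energy estimate
  (\<open>solution_pair_zero_iff\<close>): the mode is nonzero, so none of the vectors \<open>U n\<close> vanishes.

  Therefore \<open>V\<close> is a multiple of \<open>U 1\<close> and of \<open>S (U 0)\<close>; the latter is the second assertion. Since
  \<open>D (U 0) = U 1\<close> (\<open>defect_matrix_state\<close>), the vector \<open>D (S V)\<close> is a multiple of \<open>U 1\<close> too. So it
  spans no area with \<open>V\<close>, which is the first assertion.
\<close>

section \<open>Plane vectors, the area form and the mirror map\<close>

definition wedge :: "complex^2 \<Rightarrow> complex^2 \<Rightarrow> complex" where
  "wedge v w = v $ 1 * w $ 2 - v $ 2 * w $ 1"

definition flip :: "complex^2 \<Rightarrow> complex^2" where
  "flip v = vector [v $ 1, - v $ 2]"

lemma flip_nth [simp]: "flip v $ 1 = v $ 1" "flip v $ 2 = - v $ 2"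
  by (simp_all add: flip_def)

lemma norm_flip [simp]: "norm (flip v) = norm v"
  by (simp add: norm_vec_def L2_set_def sum_2)

lemma matrix_vector_2:
  fixes A :: "complex^2^2"
  shows "(A *v v) $ i = A $ i $ 1 * v $ 1 + A $ i $ 2 * v $ 2"
  by (simp add: matrix_vector_mult_def sum_2)

lemma wedge_matrix:
  fixes A :: "complex^2^2"
  shows "wedge (A *v v) (A *v w) = det A * wedge v w"
  by (simp add: wedge_def matrix_vector_2 det_2 algebra_simps)

lemma wedge_scale_right: "wedge v (k *s w) = k * wedge v w"
  by (simp add: wedge_def algebra_simps)

lemma wedge_eq_0_parallel:
  assumes "wedge v w = 0" "v \<noteq> 0"
  obtains k where "w = k *s v"
proof (cases "v $ 1 = 0")
  case True
  with assms have "v $ 2 \<noteq> 0" by (auto simp: vec_eq_iff forall_2)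
  with True assms that[of "w $ 2 / v $ 2"] show ?thesis
    by (auto simp: vec_eq_iff forall_2 wedge_def)
next
  case False
  with assms that[of "w $ 1 / v $ 1"] show ?thesis
    by (auto simp: vec_eq_iff forall_2 wedge_def field_simps)
qed

text \<open>The form \<open>wedge v (flip w)\<close> is symmetric in \<open>v\<close> and \<open>w\<close>, so applying \<open>A\<close> to the pair
  \<open>U n\<close>, \<open>flip (U (Suc n))\<close> reproduces its own area: either \<open>det A = 1\<close> or this area is \<open>0\<close>. If it is
  \<open>0\<close>, then \<open>flip (U (Suc n))\<close> is a multiple of \<open>U n\<close>, with a factor of square \<open>1\<close>, so that \<open>U\<close> does
  not shrink from \<open>n\<close> to \<open>Suc n\<close>; for a decaying sequence this cannot happen at every step.\<close>

lemma det_transfer_eq_1: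
  fixes A :: "complex^2^2" and U :: "nat \<Rightarrow> complex^2"
  assumes nz: "\<And>n. U n \<noteq> 0"
    and fwd: "\<And>n. A *v U n = U (Suc n)"
    and bwd: "\<And>n. A *v flip (U (Suc n)) = flip (U n)"
    and decay: "U \<longlonglongrightarrow> 0"
  shows "det A = 1"
proof (rule ccontr)
  assume det: "det A \<noteq> 1"
  have "norm (U (Suc n)) = norm (U n)" for n
  proof -
    have "det A * wedge (U n) (flip (U (Suc n))) = wedge (U (Suc n)) (flip (U n))"
      by (simp add: wedge_matrix[symmetric] fwd bwd)
    also have "\<dots> = wedge (U n) (flip (U (Suc n)))"
      by (simp add: wedge_def algebra_simps)
    finally have "wedge (U n) (flip (U (Suc n))) = 0" using det by simp
    then obtain k where k: "flip (U (Suc n)) = k *s U n"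
      using nz wedge_eq_0_parallel by blast
    have "flip (U n) = k *s U (Suc n)"
      by (metis bwd fwd k vector_scalar_commute)
    then have step1: "U n $ 1 = k * U (Suc n) $ 1" "- U n $ 2 = k * U (Suc n) $ 2"
      by (simp_all add: vec_eq_iff forall_2)
    have step2: "U (Suc n) $ 1 = k * U n $ 1" "- U (Suc n) $ 2 = k * U n $ 2"
      using k by (simp_all add: vec_eq_iff forall_2)
    have "U n $ i = k * k * U n $ i" for i
      using step1 step2 exhaust_2[of i] by (metis minus_mult_right minus_minus mult.assoc)
    moreover obtain i where "U n $ i \<noteq> 0" using nz[of n] by (auto simp: vec_eq_iff)
    ultimately have "k * k = 1" by (metis mult_cancel_right1)
    then have "cmod k = 1"
      by (metis norm_mult norm_one norm_ge_zero real_sqrt_abs2 real_sqrt_one abs_of_nonneg)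
    have "norm (U (Suc n)) = norm (k *s U n)"
      by (metis k norm_flip)
    also have "\<dots> = cmod k * norm (U n)"
      by (simp add: norm_vec_def L2_set_def sum_2 norm_mult power_mult_distrib
          distrib_left[symmetric] real_sqrt_mult)
    finally show ?thesis using \<open>cmod k = 1\<close> by simp
  qed
  then have const: "norm (U n) = norm (U 0)" for n by (induction n) auto
  have "(\<lambda>n. norm (U n)) = (\<lambda>n. norm (U 0))" using const by (rule ext)
  then have "(\<lambda>n. norm (U 0)) \<longlonglongrightarrow> 0" using tendsto_norm[OF decay] by (metis norm_zero)
  then show False using nz[of 0] by (simp add: LIMSEQ_const_iff)
qed

lemma decaying_orbit_parallel_eigenvector:
  fixes A :: "complex^2^2" and U :: "nat \<Rightarrow> complex^2"
  assumes det: "det A = 1"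
    and fwd: "\<And>n. A *v U n = U (Suc n)"
    and decay: "U \<longlonglongrightarrow> 0"
    and V: "A *v V = l *s V" and l: "cmod l < 1"
  shows "wedge (U 0) V = 0"
proof -
  have area: "l ^ n * wedge (U n) V = wedge (U 0) V" for n
  proof (induction n)
    case (Suc n)
    have "l * wedge (U (Suc n)) V = wedge (U n) V"
      using wedge_matrix[of A "U n" V] by (simp add: det fwd V wedge_scale_right)
    with Suc show ?case by (metis mult.assoc power_Suc2)
  qed simp
  have lin: "(\<lambda>n. wedge (U n) V) \<longlonglongrightarrow> 0"
  proof -
    have "(\<lambda>n. wedge (U n) V) \<longlonglongrightarrow> (0 :: complex^2) $ 1 * V $ 2 - (0 :: complex^2) $ 2 * V $ 1"
      unfolding wedge_def by (intro tendsto_intros decay)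
    then show ?thesis by simp
  qed
  have "(\<lambda>n. l ^ n * wedge (U n) V) \<longlonglongrightarrow> 0 * 0"
    by (intro tendsto_mult LIMSEQ_power_zero lin l)
  then show ?thesis by (simp add: area LIMSEQ_const_iff)
qed

section \<open>Solutions of the equation with a piecewise continuous coefficient\<close>

text \<open>The equation \<open>u'' + q u = 0\<close> as a first order system for the continuous pair \<open>u\<close>, \<open>p = u'\<close>, with
  finitely many exceptional points. This is all that the fundamental theorem of calculus uses, and
  unlike a second derivative it passes to the endpoints of the interval.\<close>

definition solution_pair ::
    "(real \<Rightarrow> real) \<Rightarrow> real \<Rightarrow> real \<Rightarrow> (real \<Rightarrow> 'a::real_normed_vector) \<Rightarrow> (real \<Rightarrow> 'a) \<Rightarrow> bool" where
  "solution_pair q a b u p \<longleftrightarrow>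
     continuous_on {a..b} u \<and> continuous_on {a..b} p \<and>
     (\<exists>S. finite S \<and> (\<forall>y\<in>{a<..<b} - S.
        (u has_vector_derivative p y) (at y) \<and>
        (p has_vector_derivative - (q y *\<^sub>R u y)) (at y)))"

lemma solution_on_imp_solution_pair:
  assumes c: "piecewise_smooth c" and sol: "solution_on S c \<omega> u" and sub: "{a..b} \<subseteq> S"
  shows "solution_pair (\<lambda>y. \<omega>\<^sup>2 / (c y)\<^sup>2) a b u (deriv_on S u)"
proof -
  have "\<exists>P. finite P \<and> (\<forall>y\<in>{a<..<b} - P. \<forall>k. (deriv ^^ k) c field_differentiable (at y))"
    using c unfolding piecewise_smooth_def by blast
  then obtain P where P: "finite P"
    "\<And>y k. y \<in> {a<..<b} - P \<Longrightarrow> (deriv ^^ k) c field_differentiable (at y)"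
    by blast
  have cont: "isCont c y" if "y \<in> {a<..<b} - P" for y
    using P(2)[OF that, of 0] by (simp add: field_differentiable_imp_continuous_at)
  have int: "y \<in> interior S" if "y \<in> {a<..<b}" for y
    using interior_mono[OF sub] that by auto
  have diff: "(u has_vector_derivative deriv_on S u y) (at y)" if "y \<in> interior S" for y
  proof -
    have "u differentiable (at y within S)"
      using sol that interior_subset unfolding solution_on_def differentiable_on_def by blast
    then show ?thesis
      using that by (metis at_within_interior vector_derivative_works)
  qed
  have "continuous_on S u" "continuous_on S (deriv_on S u)"
    using sol differentiable_imp_continuous_on unfolding solution_on_def by blast+
  then have "continuous_on {a..b} u" "continuous_on {a..b} (deriv_on S u)"
    using sub continuous_on_subset by blast+
  moreover have "(deriv_on S u has_vector_derivative - ((\<omega>\<^sup>2 / (c y)\<^sup>2) *\<^sub>R u y)) (at y)"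
    if "y \<in> {a<..<b} - P" for y
    using sol cont[OF that] int that unfolding solution_on_def by blast
  ultimately show ?thesis
    unfolding solution_pair_def using P(1) diff int by blast
qed

lemma solution_pair_of_real:
  assumes "solution_pair q a b u p"
  shows "solution_pair q a b (\<lambda>y. complex_of_real (u y)) (\<lambda>y. complex_of_real (p y))"
proof -
  obtain S where S: "finite S" "\<And>y. y \<in> {a<..<b} - S \<Longrightarrow>
      (u has_vector_derivative p y) (at y) \<and> (p has_vector_derivative - (q y *\<^sub>R u y)) (at y)"
    using assms unfolding solution_pair_def by blast
  have emb: "((\<lambda>y. complex_of_real (f y)) has_vector_derivative complex_of_real f') (at y)"
    if "(f has_vector_derivative f') (at y)" for f f' y
    using bounded_linear.has_vector_derivative[OF bounded_linear_of_real that] .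
  have "((\<lambda>y. complex_of_real (u y)) has_vector_derivative complex_of_real (p y)) (at y) \<and>
      ((\<lambda>y. complex_of_real (p y)) has_vector_derivative - (q y *\<^sub>R complex_of_real (u y))) (at y)"
    if "y \<in> {a<..<b} - S" for y
    using S(2)[OF that] emb[of u "p y" y] emb[of p "- (q y *\<^sub>R u y)" y]
    by (simp add: scaleR_conv_of_real)
  then show ?thesis
    using assms S(1) unfolding solution_pair_def
    by (intro conjI continuous_on_of_real) blast+
qed

lemma solution_pair_diff_scale:
  fixes u v p r :: "real \<Rightarrow> complex"
  assumes "solution_pair q a b u p" "solution_pair q a b v r"
  shows "solution_pair q a b (\<lambda>y. u y - k * v y) (\<lambda>y. p y - k * r y)"
proof -
  obtain S1 where S1: "finite S1" "\<And>y. y \<in> {a<..<b} - S1 \<Longrightarrow>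
      (u has_vector_derivative p y) (at y) \<and> (p has_vector_derivative - (q y *\<^sub>R u y)) (at y)"
    using assms(1) unfolding solution_pair_def by blast
  obtain S2 where S2: "finite S2" "\<And>y. y \<in> {a<..<b} - S2 \<Longrightarrow>
      (v has_vector_derivative r y) (at y) \<and> (r has_vector_derivative - (q y *\<^sub>R v y)) (at y)"
    using assms(2) unfolding solution_pair_def by blast
  have "((\<lambda>y. u y - k * v y) has_vector_derivative p y - k * r y) (at y) \<and>
        ((\<lambda>y. p y - k * r y) has_vector_derivative - (q y *\<^sub>R (u y - k * v y))) (at y)"
    if "y \<in> {a<..<b} - (S1 \<union> S2)" for y
  proof
    have d: "(u has_vector_derivative p y) (at y)" "(p has_vector_derivative - (q y *\<^sub>R u y)) (at y)"
      "(v has_vector_derivative r y) (at y)" "(r has_vector_derivative - (q y *\<^sub>R v y)) (at y)"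
      using S1(2)[of y] S2(2)[of y] that by auto
    show "((\<lambda>y. u y - k * v y) has_vector_derivative p y - k * r y) (at y)"
      by (intro has_vector_derivative_diff has_vector_derivative_mult_right d)
    have "((\<lambda>y. p y - k * r y) has_vector_derivative - (q y *\<^sub>R u y) - k * - (q y *\<^sub>R v y)) (at y)"
      by (intro has_vector_derivative_diff has_vector_derivative_mult_right d)
    then show "((\<lambda>y. p y - k * r y) has_vector_derivative - (q y *\<^sub>R (u y - k * v y))) (at y)"
      by (simp add: scaleR_diff_right)
  qed
  moreover have "finite (S1 \<union> S2)" using S1 S2 by simp
  ultimately show ?thesis
    using assms unfolding solution_pair_def
    by (intro conjI continuous_intros) blast+
qed

lemma solution_pair_reflect:
  assumes "solution_pair q a b u p"
    and q: "\<And>y. y \<in> {a<..<b} \<Longrightarrow> q' (s - y) = q y"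
  shows "solution_pair q' (s - b) (s - a) (\<lambda>y. u (s - y)) (\<lambda>y. - p (s - y))"
proof -
  obtain S where S: "finite S" "\<And>y. y \<in> {a<..<b} - S \<Longrightarrow>
      (u has_vector_derivative p y) (at y) \<and> (p has_vector_derivative - (q y *\<^sub>R u y)) (at y)"
    using assms(1) unfolding solution_pair_def by blast
  have refl: "((\<lambda>y. f (s - y)) has_vector_derivative - f') (at y)"
    if "(f has_vector_derivative f') (at (s - y))" for f :: "real \<Rightarrow> 'a" and f' y
  proof -
    have "((\<lambda>y. s - y) has_vector_derivative -1) (at y)"
      by (auto intro!: derivative_eq_intros)
    from vector_diff_chain_at[OF this that] show ?thesis by (simp add: o_def)
  qed
  have "((\<lambda>y. u (s - y)) has_vector_derivative - p (s - y)) (at y) \<and>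
        ((\<lambda>y. - p (s - y)) has_vector_derivative - (q' y *\<^sub>R u (s - y))) (at y)"
    if y: "y \<in> {s - b<..<s - a} - (\<lambda>y. s - y) ` S" for y
  proof -
    have "s - y \<notin> S" using y by force
    then have y': "s - y \<in> {a<..<b} - S" using y by auto
    have "((\<lambda>y. - p (s - y)) has_vector_derivative - (- (- (q (s - y) *\<^sub>R u (s - y))))) (at y)"
      using S(2)[OF y'] by (intro has_vector_derivative_minus refl) simp
    moreover have "q' y = q (s - y)" using q[of "s - y"] y' by simp
    ultimately show ?thesis using refl S(2)[OF y'] by simp
  qed
  moreover have "finite ((\<lambda>y. s - y) ` S)" using S by simp
  moreover have "continuous_on {s - b..s - a} (\<lambda>y. f (s - y))"
    if "continuous_on {a..b} f" for f :: "real \<Rightarrow> 'a"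
    by (rule continuous_on_compose2[OF that]) (auto intro!: continuous_intros)
  ultimately show ?thesis
    using assms(1) unfolding solution_pair_def
    by (intro conjI continuous_on_minus) blast+
qed

lemma wronskian_constant:
  fixes u v p r :: "real \<Rightarrow> complex"
  assumes "solution_pair q a b u p" "solution_pair q a b v r" "a \<le> b"
  shows "u b * r b - p b * v b = u a * r a - p a * v a"
proof -
  obtain S1 where S1: "finite S1" "\<And>y. y \<in> {a<..<b} - S1 \<Longrightarrow>
      (u has_vector_derivative p y) (at y) \<and> (p has_vector_derivative - (q y *\<^sub>R u y)) (at y)"
    using assms(1) unfolding solution_pair_def by blast
  obtain S2 where S2: "finite S2" "\<And>y. y \<in> {a<..<b} - S2 \<Longrightarrow>
      (v has_vector_derivative r y) (at y) \<and> (r has_vector_derivative - (q y *\<^sub>R v y)) (at y)"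
    using assms(2) unfolding solution_pair_def by blast
  have "((\<lambda>_. 0) has_integral (u b * r b - p b * v b) - (u a * r a - p a * v a)) {a..b}"
  proof (rule fundamental_theorem_of_calculus_interior_strong[of "S1 \<union> S2"])
    fix y assume y: "y \<in> {a<..<b} - (S1 \<union> S2)"
    have d: "(u has_vector_derivative p y) (at y)" "(p has_vector_derivative - (q y *\<^sub>R u y)) (at y)"
      "(v has_vector_derivative r y) (at y)" "(r has_vector_derivative - (q y *\<^sub>R v y)) (at y)"
      using S1(2)[of y] S2(2)[of y] y by auto
    have "((\<lambda>y. u y * r y - p y * v y) has_vector_derivative
        (u y * - (q y *\<^sub>R v y) + p y * r y) - (p y * r y + - (q y *\<^sub>R u y) * v y)) (at y)"
      by (intro has_vector_derivative_diff has_vector_derivative_mult d)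
    then show "((\<lambda>y. u y * r y - p y * v y) has_vector_derivative 0) (at y)" by simp
  qed (use S1 S2 assms in \<open>auto simp: solution_pair_def intro!: continuous_intros\<close>)
  then show ?thesis
    using has_integral_0[of "{a..b}"] has_integral_unique by fastforce
qed

lemma le_of_nonneg_derivative:
  fixes f g :: "real \<Rightarrow> real"
  assumes "finite S" "a \<le> b" "continuous_on {a..b} f"
    and "\<And>y. y \<in> {a<..<b} - S \<Longrightarrow> (f has_vector_derivative g y) (at y)"
    and "\<And>y. y \<in> {a..b} \<Longrightarrow> 0 \<le> g y"
  shows "f a \<le> f b"
proof -
  have "(g has_integral f b - f a) {a..b}"
    by (rule fundamental_theorem_of_calculus_interior_strong[OF assms(1,2,4,3)])
  from has_integral_nonneg[OF this assms(5)] show ?thesis by simp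
qed

text \<open>The energy \<open>|u|\<^sup>2 + |p|\<^sup>2\<close> has derivative \<open>2 (1 - q) \<langle>u, p\<rangle>\<close>, which is bounded by \<open>1 + M\<close> times the
  energy. So the energy multiplied by \<open>exp (C y)\<close> increases and multiplied by \<open>exp (- C y)\<close> decreases,
  and a zero of the energy spreads in both directions.\<close>

lemma solution_pair_zero_iff:
  fixes u p :: "real \<Rightarrow> complex"
  assumes sol: "solution_pair q a b u p" and ab: "a \<le> b"
    and M: "\<And>y. y \<in> {a..b} \<Longrightarrow> \<bar>q y\<bar> \<le> M"
  shows "u a = 0 \<and> p a = 0 \<longleftrightarrow> u b = 0 \<and> p b = 0"
proof -
  obtain S where S: "finite S" "\<And>y. y \<in> {a<..<b} - S \<Longrightarrow>
      (u has_vector_derivative p y) (at y) \<and> (p has_vector_derivative - (q y *\<^sub>R u y)) (at y)"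
    using sol unfolding solution_pair_def by blast
  have cont: "continuous_on {a..b} u" "continuous_on {a..b} p"
    using sol unfolding solution_pair_def by blast+
  define E where "E y = u y \<bullet> u y + p y \<bullet> p y" for y
  define E' where "E' y = 2 * (1 - q y) * (u y \<bullet> p y)" for y
  define C where "C = 1 + M"
  have E_cont: "continuous_on {a..b} E"
    unfolding E_def by (intro continuous_intros cont)
  have E_deriv: "(E has_vector_derivative E' y) (at y)" if "y \<in> {a<..<b} - S" for y
  proof -
    have d: "(u has_derivative (\<lambda>t. t *\<^sub>R p y)) (at y)"
      "(p has_derivative (\<lambda>t. t *\<^sub>R - (q y *\<^sub>R u y))) (at y)"
      using S(2)[OF that] unfolding has_vector_derivative_def by auto
    have "(E has_derivative (\<lambda>t. (u y \<bullet> (t *\<^sub>R p y) + (t *\<^sub>R p y) \<bullet> u y)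
        + (p y \<bullet> (t *\<^sub>R - (q y *\<^sub>R u y)) + (t *\<^sub>R - (q y *\<^sub>R u y)) \<bullet> p y))) (at y)"
      unfolding E_def by (intro has_derivative_add has_derivative_inner d)
    then show ?thesis
      unfolding has_vector_derivative_def E'_def
      by (rule has_derivative_eq_rhs) (auto simp: inner_commute algebra_simps)
  qed
  have E_bound: "\<bar>E' y\<bar> \<le> C * E y" if "y \<in> {a..b}" for y
  proof -
    have "2 * \<bar>u y \<bullet> p y\<bar> \<le> 2 * (norm (u y) * norm (p y))"
      using Cauchy_Schwarz_ineq2[of "u y" "p y"] by simp
    also have "\<dots> \<le> E y"
      using sum_squares_bound[of "norm (u y)" "norm (p y)"]
      by (simp add: E_def dot_square_norm)
    finally have "2 * \<bar>u y \<bullet> p y\<bar> \<le> E y" .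
    moreover have "\<bar>1 - q y\<bar> \<le> C" using M[OF that] by (simp add: C_def)
    ultimately have "\<bar>1 - q y\<bar> * (2 * \<bar>u y \<bullet> p y\<bar>) \<le> C * E y" by (intro mult_mono) auto
    moreover have "\<bar>E' y\<bar> = \<bar>1 - q y\<bar> * (2 * \<bar>u y \<bullet> p y\<bar>)"
      unfolding E'_def abs_mult by simp
    ultimately show ?thesis by simp
  qed
  have E_nonneg: "0 \<le> E y" for y by (simp add: E_def)
  have E_zero: "E y = 0 \<longleftrightarrow> u y = 0 \<and> p y = 0" for y
    by (simp add: E_def add_nonneg_eq_0_iff)
  have exp_deriv: "((\<lambda>y. exp (k * y) * E y) has_vector_derivative exp (k * y) * (k * E y + E' y)) (at y)"
    if "y \<in> {a<..<b} - S" for k y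
    using E_deriv[OF that] unfolding has_real_derivative_iff_has_vector_derivative[symmetric]
    by (auto intro!: derivative_eq_intros simp: algebra_simps)
  have up: "exp (C * a) * E a \<le> exp (C * b) * E b"
  proof (rule le_of_nonneg_derivative[OF S(1) ab, of "\<lambda>y. exp (C * y) * E y"])
    show "0 \<le> exp (C * y) * (C * E y + E' y)" if "y \<in> {a..b}" for y
      using E_bound[OF that] by (intro mult_nonneg_nonneg) auto
  qed (auto intro!: continuous_intros E_cont exp_deriv)
  have down: "- (exp (- C * a) * E a) \<le> - (exp (- C * b) * E b)"
  proof (rule le_of_nonneg_derivative[OF S(1) ab, of "\<lambda>y. - (exp (- C * y) * E y)"])
    show "0 \<le> - (exp (- C * y) * (- C * E y + E' y))" if "y \<in> {a..b}" for y
      using E_bound[OF that] by (simp add: mult_le_0_iff)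
    show "((\<lambda>y. - (exp (- C * y) * E y)) has_vector_derivative
        - (exp (- C * y) * (- C * E y + E' y))) (at y)" if "y \<in> {a<..<b} - S" for y
      by (intro has_vector_derivative_minus exp_deriv that)
  qed (auto intro!: continuous_intros E_cont)
  have "E a = 0 \<longleftrightarrow> E b = 0"
  proof
    assume "E a = 0"
    with down E_nonneg[of b] show "E b = 0" by (simp add: mult_le_0_iff)
  next
    assume "E b = 0"
    with up E_nonneg[of a] show "E a = 0" by (simp add: mult_le_0_iff)
  qed
  then show ?thesis by (simp add: E_zero)
qed

text \<open>On a unit interval \<open>[y, y + 1]\<close> where \<open>|u| \<le> \<delta>\<close>, the equation makes \<open>p\<close> vary by at most
  \<open>M \<delta>\<close>, whereas \<open>u\<close> varies by at most \<open>2 \<delta>\<close>; so \<open>|p y| \<le> (2 + M) \<delta>\<close>.\<close>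

lemma derivative_decays:
  fixes u p :: "real \<Rightarrow> complex"
  assumes sol: "\<And>b. solution_pair q a b u p"
    and M: "\<And>y. y \<ge> a \<Longrightarrow> \<bar>q y\<bar> \<le> M"
    and u: "(u \<longlongrightarrow> 0) at_top"
  shows "(p \<longlongrightarrow> 0) at_top"
proof (rule tendstoI)
  fix \<epsilon> :: real assume "\<epsilon> > 0"
  have M0: "0 \<le> M" using M[of a] by simp
  define \<delta> where "\<delta> = \<epsilon> / (3 + M)"
  have \<delta>: "\<delta> > 0" "(3 + M) * \<delta> = \<epsilon>" using \<open>\<epsilon> > 0\<close> M0 by (simp_all add: \<delta>_def)
  obtain N where N: "\<And>y. y \<ge> N \<Longrightarrow> norm (u y) < \<delta>"
    using tendstoD[OF u \<delta>(1)] by (auto simp: eventually_at_top_linorder)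
  have "norm (p y) < \<epsilon>" if y: "y \<ge> N" "y \<ge> a" for y
  proof -
    obtain S where S: "finite S" "\<And>t. t \<in> {a<..<y + 1} - S \<Longrightarrow>
        (u has_vector_derivative p t) (at t) \<and> (p has_vector_derivative - (q t *\<^sub>R u t)) (at t)"
      using sol[of "y + 1"] unfolding solution_pair_def by blast
    have cont: "continuous_on {y..t} u" "continuous_on {y..t} p" if "t \<le> y + 1" for t
      using sol[of "y + 1"] that y unfolding solution_pair_def
      by (meson atLeastatMost_subset_iff continuous_on_subset)+
    have p_var: "norm (p t - p y) \<le> M * \<delta>" if t: "t \<in> {y..y + 1}" for t
    proof -
      have "((\<lambda>s. - (q s *\<^sub>R u s)) has_integral p t - p y) {y..t}"
        using S t y cont
        by (intro fundamental_theorem_of_calculus_interior_strong[OF S(1)]) auto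
      moreover have "norm (- (q s *\<^sub>R u s)) \<le> M * \<delta>" if "s \<in> {y..t}" for s
        using M[of s] N[of s] that y M0 by (auto simp: intro!: mult_mono)
      ultimately have "norm (p t - p y) \<le> M * \<delta> * measure lborel (cbox y t)"
        using \<delta> M0 by (intro has_integral_bound) (auto simp: cbox_interval)
      also have "\<dots> \<le> M * \<delta> * 1"
        using t \<delta> M0 by (intro mult_left_mono) auto
      finally show ?thesis by simp
    qed
    have "((\<lambda>t. p t - p y) has_integral
        (u (y + 1) - (y + 1) *\<^sub>R p y) - (u y - y *\<^sub>R p y)) {y..y + 1}"
    proof (rule fundamental_theorem_of_calculus_interior_strong[OF S(1)])
      show "((\<lambda>t. u t - t *\<^sub>R p y) has_vector_derivative p t - p y) (at t)"
        if "t \<in> {y<..<y + 1} - S" for t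
      proof -
        have "(u has_vector_derivative p t) (at t)" using S(2)[of t] that y by auto
        moreover have "((\<lambda>t. t *\<^sub>R p y) has_vector_derivative p y) (at t)"
          by (auto intro!: derivative_eq_intros)
        ultimately show ?thesis by (rule has_vector_derivative_diff)
      qed
    qed (auto intro!: continuous_intros cont)
    then have "norm ((u (y + 1) - (y + 1) *\<^sub>R p y) - (u y - y *\<^sub>R p y))
        \<le> M * \<delta> * measure lborel (cbox y (y + 1))"
      using \<delta> M0 p_var by (intro has_integral_bound) (auto simp: cbox_interval)
    then have "norm (u (y + 1) - u y - p y) \<le> M * \<delta>" by (simp add: algebra_simps)
    moreover have "norm (p y) \<le> norm (u (y + 1)) + norm (u y) + norm (u (y + 1) - u y - p y)"
      by norm
    moreover have "norm (u (y + 1)) < \<delta>" "norm (u y) < \<delta>" using N y by auto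
    moreover have "M * \<delta> + 2 * \<delta> < \<epsilon>" using \<delta> by (simp add: algebra_simps)
    ultimately show ?thesis by linarith
  qed
  then show "\<forall>\<^sub>F y in at_top. dist (p y) 0 < \<epsilon>"
    unfolding eventually_at_top_linorder by (intro exI[of _ "max N a"]) auto
qed

text \<open>A positive function with positive one-sided limits need not be continuous, but it is still
  bounded below by a positive number near each point; compactness does the rest.\<close>

lemma positive_lower_bound_on_compact:
  fixes c :: "real \<Rightarrow> real"
  assumes pos: "\<And>y. c y > 0"
    and left: "\<And>y. \<exists>l>0. (c \<longlongrightarrow> l) (at_left y)"
    and right: "\<And>y. \<exists>l>0. (c \<longlongrightarrow> l) (at_right y)"
  obtains m where "m > 0" "\<And>y. y \<in> {a..b} \<Longrightarrow> m \<le> c y"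
proof -
  have local: "\<exists>U m. open U \<and> y \<in> U \<and> m > 0 \<and> (\<forall>z\<in>U. m \<le> c z)" for y
  proof -
    obtain l where l: "l > 0" "(c \<longlongrightarrow> l) (at_left y)" using left by blast
    obtain r where r: "r > 0" "(c \<longlongrightarrow> r) (at_right y)" using right by blast
    define m where "m = min (c y) (min (l / 2) (r / 2))"
    have m: "m > 0" "m \<le> c y" "m < l" "m < r" using pos[of y] l r by (auto simp: m_def)
    have "\<forall>\<^sub>F z in at_left y. m < c z" "\<forall>\<^sub>F z in at_right y. m < c z"
      using order_tendstoD(1)[OF l(2) m(3)] order_tendstoD(1)[OF r(2) m(4)] by auto
    then have "\<forall>\<^sub>F z in at y. m < c z" by (simp add: eventually_at_split)
    then obtain U where "open U" "y \<in> U" "\<forall>z\<in>U. z \<noteq> y \<longrightarrow> m < c z"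
      by (auto simp: eventually_at_topological)
    with m show ?thesis by (metis less_imp_le)
  qed
  then obtain U m where Um: "\<And>y. open (U y)" "\<And>y. y \<in> U y" "\<And>y. m y > (0::real)"
    "\<And>y z. z \<in> U y \<Longrightarrow> m y \<le> c z"
    by metis
  have "compact {a..b}" by simp
  then obtain F where F: "F \<subseteq> {a..b}" "finite F" "{a..b} \<subseteq> (\<Union>y\<in>F. U y)"
    by (rule compactE_image[of _ "{a..b}" U]) (use Um in auto)
  \<comment> \<open>The number \<open>1\<close> only keeps the minimum defined when the interval is empty.\<close>
  let ?m = "Min (insert 1 (m ` F))"
  have "?m > 0" using F Um by auto
  moreover have "?m \<le> c z" if z: "z \<in> {a..b}" for z
  proof -
    obtain y where "y \<in> F" "z \<in> U y" using F(3) z by blast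
    then have "?m \<le> m y" using F by (intro Min_le) auto
    then show ?thesis using Um(4)[OF \<open>z \<in> U y\<close>] by simp
  qed
  ultimately show ?thesis using that by blast
qed

section \<open>The periodic medium outside the defect\<close>

context defect_medium
begin

lemma grid_right: "x (1 + int n) = x 1 + real n * h"
proof (induction n)
  case (Suc n)
  then show ?case using grid[of "1 + int n"] by (simp add: algebra_simps)
qed simp

lemma grid_left: "x (- int n) = x 0 - real n * h"
proof (induction n)
  case (Suc n)
  then show ?case using grid[of "- int (Suc n)"] by (simp add: algebra_simps)
qed simp

lemma right_cell:
  assumes "y \<ge> x 1"
  obtains n t where "t \<in> {0..<h}" "y = x (1 + int n) + t"
proof -
  let ?z = "(y - x 1) / h"
  have "?z \<ge> 0" using assms h_pos by simp
  then have fl: "real (nat \<lfloor>?z\<rfloor>) = of_int \<lfloor>?z\<rfloor>" by simp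
  have "h * frac ?z \<in> {0..<h}"
    using frac_ge_0[of ?z] frac_lt_1[of ?z] h_pos by simp
  moreover have "y = x (1 + int (nat \<lfloor>?z\<rfloor>)) + h * frac ?z"
    unfolding grid_right fl frac_def using h_pos by (simp add: field_simps)
  ultimately show ?thesis using that by blast
qed

text \<open>Mirroring about the defect carries the cell starting at \<open>x (1 + n)\<close>, read to the right, to the
  cell ending at \<open>x (- n)\<close>, read to the left; the symmetry of the cell undoes the change of
  direction.\<close>

lemma c_mirror:
  assumes "y \<ge> x 1"
  shows "c (x 0 + x 1 - y) = c y"
proof -
  obtain n t where t: "t \<in> {0..<h}" and y: "y = x (1 + int n) + t"
    using right_cell[OF assms] by blast
  let ?m = "- int (Suc n)"
  have "x 0 + x 1 - y = x (- int n) - t" by (simp add: y grid_right grid_left)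
  also have "- int n = ?m + 1" by simp
  also have "c (x (?m + 1) - t) = c (x ?m + t)" using c_symmetric[of ?m t] t by simp
  also have "\<dots> = c y" unfolding y using t by (intro c_periodic) auto
  finally show ?thesis .
qed

lemma coefficient_bounded:
  obtains M where "\<And>y. y \<in> {a..b} \<Longrightarrow> \<bar>\<omega>\<^sup>2 / (c y)\<^sup>2\<bar> \<le> M"
proof -
  obtain m where m: "m > 0" "\<And>y. y \<in> {a..b} \<Longrightarrow> m \<le> c y"
    using positive_lower_bound_on_compact[of c] c_pos c_left_limit c_right_limit by metis
  then have "\<bar>\<omega>\<^sup>2 / (c y)\<^sup>2\<bar> \<le> \<omega>\<^sup>2 / m\<^sup>2" if "y \<in> {a..b}" for y
    using that c_pos[of y] by (auto intro!: divide_left_mono power_mono mult_pos_pos)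
  then show ?thesis using that by blast
qed

lemma coefficient_bounded_right:
  obtains M where "\<And>y. y \<ge> x 1 \<Longrightarrow> \<bar>\<omega>\<^sup>2 / (c y)\<^sup>2\<bar> \<le> M"
proof -
  obtain M where M: "\<And>y. y \<in> {x 1..x 1 + h} \<Longrightarrow> \<bar>\<omega>\<^sup>2 / (c y)\<^sup>2\<bar> \<le> M"
    using coefficient_bounded by blast
  have "\<bar>\<omega>\<^sup>2 / (c y)\<^sup>2\<bar> \<le> M" if y: "y \<ge> x 1" for y
  proof -
    obtain n t where "t \<in> {0..<h}" "y = x (1 + int n) + t"
      using right_cell[OF y] by blast
    then have "c y = c (x 1 + t)" "x 1 + t \<in> {x 1..x 1 + h}"
      using c_periodic[of "1 + int n" 1 t] by auto
    then show ?thesis using M by metis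
  qed
  then show ?thesis using that by blast
qed

text \<open>The solution matrix of the defect is invertible with determinant \<open>1\<close>, again by the Wronskian;
  so the Wronskians of \<open>u\<close> with the two columns determine \<open>u\<close> at \<open>x 1\<close>.\<close>

lemma defect_matrix_state:
  assumes D: "is_defect_matrix (x 0) (x 1) c \<omega> D" and u: "solution_on UNIV c \<omega> u"
  shows "state u (x 1) = map_matrix complex_of_real D *v state u (x 0)"
proof -
  let ?q = "\<lambda>y. \<omega>\<^sup>2 / (c y)\<^sup>2"
  let ?I = "{x 0..x 1}"
  obtain \<psi>1 \<psi>2 :: "real \<Rightarrow> real" where
    sol: "solution_on ?I c \<omega> \<psi>1" "solution_on ?I c \<omega> \<psi>2"
    and init: "\<psi>1 (x 0) = 1" "deriv_on ?I \<psi>1 (x 0) = 0" "\<psi>2 (x 0) = 0" "deriv_on ?I \<psi>2 (x 0) = 1"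
    and D_eq: "D = vector [vector [\<psi>1 (x 1), \<psi>2 (x 1)],
                    vector [deriv_on ?I \<psi>1 (x 1), deriv_on ?I \<psi>2 (x 1)]]"
    using D unfolding is_defect_matrix_def by blast
  note pu = solution_on_imp_solution_pair[OF c_smooth u subset_UNIV, of "x 0" "x 1"]
  note p1 = solution_pair_of_real[OF solution_on_imp_solution_pair[OF c_smooth sol(1) subset_refl]]
  note p2 = solution_pair_of_real[OF solution_on_imp_solution_pair[OF c_smooth sol(2) subset_refl]]
  have le: "x 0 \<le> x 1" using defect_nonempty by simp
  define A B A' B' where "A = complex_of_real (\<psi>1 (x 1))" and "B = complex_of_real (\<psi>2 (x 1))"
    and "A' = complex_of_real (deriv_on ?I \<psi>1 (x 1))"
    and "B' = complex_of_real (deriv_on ?I \<psi>2 (x 1))"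
  define v v' w w' where "v = u (x 0)" and "v' = vector_derivative u (at (x 0))"
    and "w = u (x 1)" and "w' = vector_derivative u (at (x 1))"
  have W12: "A * B' - A' * B = 1"
    using wronskian_constant[OF p1 p2 le] by (simp add: init A_def B_def A'_def B'_def)
  have Wu1: "w * A' - w' * A = - v'"
    using wronskian_constant[OF pu p1 le]
    by (simp add: init A_def A'_def v_def v'_def w_def w'_def)
  have Wu2: "w * B' - w' * B = v"
    using wronskian_constant[OF pu p2 le]
    by (simp add: init B_def B'_def v_def v'_def w_def w'_def)
  have "w = w * (A * B' - A' * B)" using W12 by simp
  also have "\<dots> = A * (w * B' - w' * B) - B * (w * A' - w' * A)" by (simp add: algebra_simps)
  finally have w: "w = A * v + B * v'" by (simp add: Wu1 Wu2)
  have "w' = w' * (A * B' - A' * B)" using W12 by simp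
  also have "\<dots> = A' * (w * B' - w' * B) - B' * (w * A' - w' * A)" by (simp add: algebra_simps)
  finally have w': "w' = A' * v + B' * v'" by (simp add: Wu1 Wu2)
  show ?thesis
    using w w' unfolding vec_eq_iff forall_2 matrix_vector_2
    by (simp add: state_def D_eq A_def B_def A'_def B'_def v_def v'_def w_def w'_def)
qed

lemma state_nonzero:
  assumes u: "solution_on UNIV c \<omega> u"
  shows "state u y \<noteq> 0"
proof
  assume "state u y = 0"
  then have y: "u y = 0 \<and> vector_derivative u (at y) = 0"
    by (simp add: state_def vec_eq_iff forall_2)
  have "u z = 0" for z
  proof -
    obtain M where M: "\<And>t. t \<in> {min y z..max y z} \<Longrightarrow> \<bar>\<omega>\<^sup>2 / (c t)\<^sup>2\<bar> \<le> M"
      using coefficient_bounded by blast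
    show ?thesis
      using solution_pair_zero_iff[OF solution_on_imp_solution_pair[OF c_smooth u subset_UNIV],
          of "min y z" "max y z" M] M y
      by (cases "y \<le> z") (auto simp: min_def max_def)
  qed
  then show False using u unfolding solution_on_def by simp
qed

text \<open>The mode on the right of the defect is a multiple of its mirror image, since their Wronskian is
  constant and decays.\<close>

lemma mode_parallel_mirror:
  assumes mode: "localised_eigenmode c \<omega> u"
  obtains k where "k \<noteq> 0" "\<And>n. state u (x (1 + int n)) = k *s flip (state u (x (- int n)))"
    "(\<lambda>n. state u (x (1 + int n))) \<longlonglongrightarrow> 0"
proof -
  let ?q = "\<lambda>y. \<omega>\<^sup>2 / (c y)\<^sup>2"
  let ?s = "x 0 + x 1"
  define p where "p y = vector_derivative u (at y)" for y
  have u: "solution_on UNIV c \<omega> u" and lim: "(u \<longlongrightarrow> 0) at_top" "(u \<longlongrightarrow> 0) at_bot"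
    using mode unfolding localised_eigenmode_def by auto
  have pair: "solution_pair ?q a b u p" for a b
    using solution_on_imp_solution_pair[OF c_smooth u subset_UNIV] by (simp add: p_def[abs_def])
  define w r where "w y = u (?s - y)" and "r y = - p (?s - y)" for y
  have mirror: "solution_pair ?q (x 1) b w r" for b
  proof -
    have "solution_pair ?q (?s - x 0) (?s - (?s - b)) (\<lambda>y. u (?s - y)) (\<lambda>y. - p (?s - y))"
    proof (rule solution_pair_reflect[OF pair])
      fix y assume "y \<in> {?s - b<..<x 0}"
      then have "c (?s - (?s - y)) = c (?s - y)" by (intro c_mirror) auto
      then show "?q (?s - y) = ?q y" by simp
    qed
    then show ?thesis by (simp add: w_def[abs_def] r_def[abs_def])
  qed
  obtain M where M: "\<And>y. y \<ge> x 1 \<Longrightarrow> \<bar>?q y\<bar> \<le> M" using coefficient_bounded_right by blast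
  have "filterlim (\<lambda>y. ?s - y) at_bot at_top"
    unfolding filterlim_at_bot eventually_at_top_linorder
  proof
    fix Z show "\<exists>N. \<forall>y\<ge>N. ?s - y \<le> Z" by (rule exI[of _ "?s - Z"]) auto
  qed
  from filterlim_compose[OF lim(2) this] have w_lim: "(w \<longlongrightarrow> 0) at_top"
    by (simp add: w_def[abs_def])
  have p_lim: "(p \<longlongrightarrow> 0) at_top" by (rule derivative_decays[OF pair M lim(1)])
  have r_lim: "(r \<longlongrightarrow> 0) at_top" by (rule derivative_decays[OF mirror M w_lim])
  have "((\<lambda>y. w y * p y - r y * u y) \<longlongrightarrow> 0 * 0 - 0 * 0) at_top"
    by (intro tendsto_intros w_lim p_lim r_lim lim)
  moreover have "\<forall>\<^sub>F y in at_top. w y * p y - r y * u y = w (x 1) * p (x 1) - r (x 1) * u (x 1)"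
    using wronskian_constant[OF mirror pair] unfolding eventually_at_top_linorder by blast
  ultimately have "((\<lambda>y::real. w (x 1) * p (x 1) - r (x 1) * u (x 1)) \<longlongrightarrow> 0) at_top"
    using tendsto_cong by fastforce
  then have "w (x 1) * p (x 1) - r (x 1) * u (x 1) = 0"
    by (simp add: tendsto_const_iff)
  then have "wedge (flip (state u (x 0))) (state u (x 1)) = 0"
    by (simp add: wedge_def state_def w_def r_def p_def)
  moreover have "flip (state u (x 0)) \<noteq> 0"
    using state_nonzero[OF u, of "x 0"] by (metis norm_flip norm_eq_zero)
  ultimately obtain k where k: "state u (x 1) = k *s flip (state u (x 0))"
    using wedge_eq_0_parallel by blast
  have "k \<noteq> 0" using k state_nonzero[OF u, of "x 1"] by auto
  have start: "u (x 1) - k * w (x 1) = 0 \<and> p (x 1) - k * r (x 1) = 0"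
    using k by (simp add: vec_eq_iff forall_2 state_def w_def r_def p_def)
  have same: "u y - k * w y = 0 \<and> p y - k * r y = 0" if "y \<ge> x 1" for y
    using solution_pair_zero_iff[OF solution_pair_diff_scale[OF pair mirror] that M] start by simp
  have "state u (x (1 + int n)) = k *s flip (state u (x (- int n)))" for n
  proof -
    have "x (1 + int n) \<ge> x 1" using h_pos by (simp add: grid_right)
    moreover have "?s - x (1 + int n) = x (- int n)" by (simp add: grid_right grid_left)
    ultimately show ?thesis
      using same[of "x (1 + int n)"]
      by (simp add: vec_eq_iff forall_2 state_def w_def r_def p_def eq_neg_iff_add_eq_0)
  qed
  moreover have "(\<lambda>n. state u (x (1 + int n))) \<longlonglongrightarrow> 0"
  proof -
    have "filterlim (\<lambda>n. x 1 + real n * h) at_top sequentially"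
      using h_pos by (intro filterlim_tendsto_add_at_top[OF tendsto_const]
          filterlim_at_top_mult_tendsto_pos[OF tendsto_const] filterlim_real_sequentially)
    then have g: "filterlim (\<lambda>n. x (1 + int n)) at_top sequentially" by (simp add: grid_right)
    have "(\<lambda>n. state u (x (1 + int n)) $ i) \<longlonglongrightarrow> 0 $ i" for i
      using filterlim_compose[OF lim(1) g] filterlim_compose[OF p_lim g] exhaust_2[of i]
      by (auto simp: state_def p_def)
    then show ?thesis by (rule vec_tendstoI)
  qed
  ultimately show ?thesis using that \<open>k \<noteq> 0\<close> by blast
qed

end

section \<open>Necessary condition for a localised mode\<close>

theorem theorem2p4:
  fixes h \<omega> :: real and x :: "int \<Rightarrow> real" and c :: "real \<Rightarrow> real"
    and T D :: "real^2^2" and u :: "real \<Rightarrow> complex"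
    and l\<^sub>1 :: complex and V :: "complex^2"
  assumes "defect_medium h x c"
    and "\<omega> \<notin> spectrum h (unperturbed h x c)"
    and "is_transfer_matrix x c \<omega> T"
    and "is_defect_matrix (x 0) (x 1) c \<omega> D"
    and "localised_eigenmode c \<omega> u"
    and "is_eigenvector (map_matrix complex_of_real T) l\<^sub>1 V" and "cmod l\<^sub>1 < 1"
  shows "(rowvector (vector [- V $ 2, V $ 1]) :: complex^2^1) ** map_matrix complex_of_real D
           ** (columnvector (vector [V $ 1, - V $ 2]) :: complex^1^2) = 0
       \<and> V $ 2 * u (x 0) = - V $ 1 * vector_derivative u (at (x 0))"
proof -
  interpret defect_medium h x c by fact
  let ?T = "map_matrix complex_of_real T" and ?D = "map_matrix complex_of_real D"
  have u: "solution_on UNIV c \<omega> u" using assms(5) unfolding localised_eigenmode_def by simp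
  have transfer: "?T *v state u (x n) = state u (x (n + 1))" if "n \<noteq> 0" for n
    using assms(3) u that unfolding is_transfer_matrix_def by simp
  have V: "?T *v V = l\<^sub>1 *s V" using assms(6) unfolding is_eigenvector_def by auto
  obtain k where k: "k \<noteq> 0"
    and mirror: "\<And>n. state u (x (1 + int n)) = k *s flip (state u (x (- int n)))"
    and decay: "(\<lambda>n. state u (x (1 + int n))) \<longlonglongrightarrow> 0"
    using mode_parallel_mirror[OF assms(5)] by blast
  \<comment> \<open>Counting starts at the right edge of the defect, so that \<open>U 0\<close> is the state at \<open>x 1\<close>.\<close>
  define U where "U n = state u (x (1 + int n))" for n
  have U_nz: "U n \<noteq> 0" for n unfolding U_def by (rule state_nonzero[OF u])
  have fwd: "?T *v U n = U (Suc n)" for n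
    using transfer[of "1 + int n"] by (simp add: U_def add_ac)
  have flip_U: "flip (U n) = k *s state u (x (- int n))" for n
    unfolding U_def mirror by (simp add: vec_eq_iff forall_2)
  have bwd: "?T *v flip (U (Suc n)) = flip (U n)" for n
    using transfer[of "- int (Suc n)"] by (simp add: flip_U vector_scalar_commute)
  have U_lim: "U \<longlonglongrightarrow> 0" using decay by (simp add: U_def[abs_def])
  have "det ?T = 1" by (rule det_transfer_eq_1[OF U_nz fwd bwd U_lim])
  then have par: "wedge (U 0) V = 0"
    by (rule decaying_orbit_parallel_eigenvector[OF _ fwd U_lim V assms(7)])
  obtain m where m: "V = m *s U 0" using wedge_eq_0_parallel[OF par U_nz] by blast
  have U0: "U 0 = k *s flip (state u (x 0))" using mirror[of 0] by (simp add: U_def)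
  have flip_V: "flip V = (m * k) *s state u (x 0)"
    unfolding m U0 by (simp add: vec_eq_iff forall_2)
  have "?D *v flip V = (m * k) *s U 0"
    using defect_matrix_state[OF assms(4) u]
    by (simp add: flip_V U_def vector_scalar_commute)
  then have "wedge V (?D *v flip V) = 0"
    unfolding m by (simp add: wedge_def algebra_simps)
  moreover have "((rowvector (vector [- V $ 2, V $ 1]) :: complex^2^1) ** ?D
           ** (columnvector (vector [V $ 1, - V $ 2]) :: complex^1^2)) $ i $ j
      = wedge V (?D *v flip V)" for i j
    by (simp add: matrix_matrix_mult_def sum_2 rowvector_def columnvector_def wedge_def
        matrix_vector_2 algebra_simps)
  ultimately have first: "(rowvector (vector [- V $ 2, V $ 1]) :: complex^2^1) ** ?D
           ** (columnvector (vector [V $ 1, - V $ 2]) :: complex^1^2) = 0"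
    by (simp add: vec_eq_iff)
  have "V $ 1 = m * k * u (x 0)" "V $ 2 = - (m * k * vector_derivative u (at (x 0)))"
    using flip_V by (simp_all add: vec_eq_iff forall_2 state_def minus_equation_iff[of "V $ 2"])
  then show ?thesis using first by simp
qed

end
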